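(* Let $\mathbb{K}\in\{\mathbb{R},\mathbb{C}\}$ and let $\mathcal{V}$ be a linear subspace of $M_n(\mathbb{K})$ that contains at least one nonsingular matrix. The following are equivalent: (i) there exists a nonsingular $A\in\mathcal{V}$ such that $A^{-1}\mathcal{V}$ is a commuting subspace; (ii) for every nonsingular $A\in\mathcal{V}$, $A^{-1}\mathcal{V}$ is a commuting subspace.
   Context: $A^{-1}\mathcal{V}=\{A^{-1}M: M\in\mathcal{V}\}$. A subspace of matrices is commuting if any two of its elements commute. *)

theory Defs
  imports "HOL-Analysis.Analysis"
begin

text \<open>
  Entrywise multiplication by a scalar of the base field. The library's \<open>subspace\<close> is
  \<open>\<real>\<close>-linear and \<open>vec.subspace\<close> on \<open>'a^'n^'m\<close> does not type-check, so linear subspaces of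
  matrices over \<open>'a\<close> are obtained from the module locale: \<open>matrix_space.subspace\<close> is
  linearity over \<open>'a\<close> itself, in particular \<open>\<complex>\<close>-linearity for complex matrices.
\<close>

definition matrix_scale :: "'a::field \<Rightarrow> 'a^'n^'m \<Rightarrow> 'a^'n^'m"
  where "matrix_scale c M = map_matrix ((*) c) M"

global_interpretation matrix_space: vector_space "matrix_scale :: 'a::field \<Rightarrow> 'a^'n^'m \<Rightarrow> 'a^'n^'m"
  by unfold_locales (simp_all add: matrix_scale_def vec_eq_iff algebra_simps)

definition commuting_subspace :: "('a::field^'n^'n) set \<Rightarrow> bool"
  where "commuting_subspace W \<longleftrightarrow>
    matrix_space.subspace W \<and> (\<forall>X\<in>W. \<forall>Y\<in>W. X ** Y = Y ** X)"

definition inv_translate :: "'a::field^'n^'n \<Rightarrow> ('a^'n^'n) set \<Rightarrow> ('a^'n^'n) set"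
  where "inv_translate A V = (\<lambda>M. matrix_inv A ** M) ` V"

end

theory Submission
  imports Defs
begin

text \<open>
  If \<open>A\<inverse>V\<close> is commuting and \<open>B \<in> V\<close> is nonsingular, then \<open>C = A\<inverse>B\<close> lies in \<open>A\<inverse>V\<close>, so \<open>C\<inverse>\<close> commutes
  with all of \<open>A\<inverse>V\<close>; hence the elements \<open>B\<inverse>X = C\<inverse>(A\<inverse>X)\<close> of \<open>B\<inverse>V\<close> commute with each other.
\<close>

lemma matrix_inv_cancel:
  fixes A :: "'a::field^'n^'n"
  assumes "invertible A"
  shows "A ** matrix_inv A = mat 1" "matrix_inv A ** A = mat 1"
  using assms someI_ex[of "\<lambda>B. A ** B = mat 1 \<and> B ** A = mat 1"]
  unfolding invertible_def matrix_inv_def by auto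

lemma matrix_mul_matrix_scale:
  fixes A M :: "'a::field^'n^'n"
  shows "A ** matrix_scale c M = matrix_scale c (A ** M)"
  by (simp add: matrix_scale_def matrix_matrix_mult_def vec_eq_iff sum_distrib_left mult_ac)

text \<open>Left multiplication by the fixed matrix \<open>matrix_inv A\<close> is linear over the
  base field, and linear images of subspaces are subspaces.\<close>

lemma subspace_inv_translate:
  assumes "matrix_space.subspace V"
  shows "matrix_space.subspace (inv_translate A V)"
proof (rule matrix_space.subspaceI)
  show "0 \<in> inv_translate A V"
    using matrix_space.subspace_0[OF assms] by (force simp: inv_translate_def)
next
  fix X Y assume "X \<in> inv_translate A V" "Y \<in> inv_translate A V"
  then show "X + Y \<in> inv_translate A V"
    using matrix_space.subspace_add[OF assms]
    by (auto simp: inv_translate_def simp flip: matrix_add_ldistrib)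
next
  fix c X assume "X \<in> inv_translate A V"
  then show "matrix_scale c X \<in> inv_translate A V"
    using matrix_space.subspace_scale[OF assms]
    by (auto simp: inv_translate_def simp flip: matrix_mul_matrix_scale)
qed

text \<open>Multiplying \<open>C ** P = P ** C\<close> by \<open>D\<close> on the left and on the
  right turns its two sides into \<open>P ** D\<close> and \<open>D ** P\<close>.\<close>

lemma commute_left_inverse:
  fixes C D P :: "'a::semiring_1^'n^'n"
  assumes "D ** C = mat 1" "C ** D = mat 1" "C ** P = P ** C"
  shows "D ** P = P ** D"
proof -
  have "D ** P = D ** (P ** C) ** D"
    using assms(2) by (simp flip: matrix_mul_assoc)
  also have "\<dots> = (D ** C) ** P ** D"
    using assms(3) by (simp flip: matrix_mul_assoc)
  finally show ?thesis
    using assms(1) by simp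
qed

lemma commuting_inv_translate_change:
  fixes V :: "('a::field^'n^'n) set"
  assumes V: "matrix_space.subspace V"
    and A: "invertible A" "commuting_subspace (inv_translate A V)"
    and B: "B \<in> V" "invertible B"
  shows "commuting_subspace (inv_translate B V)"
proof -
  define C where "C = matrix_inv A ** B"
  \<comment> \<open>This is the inverse of \<open>C\<close>, given explicitly so that its products
    expand into factors of \<open>A\<close>, \<open>B\<close> and their inverses.\<close>
  define D where "D = matrix_inv B ** A"
  note invA = matrix_inv_cancel[OF A(1)] and invB = matrix_inv_cancel[OF B(2)]
  have comm: "P ** Q = Q ** P" if "P \<in> inv_translate A V" "Q \<in> inv_translate A V" for P Q
    using A(2) that by (simp add: commuting_subspace_def)
  have "D ** C = matrix_inv B ** (A ** matrix_inv A) ** B"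
    by (simp add: C_def D_def matrix_mul_assoc)
  then have DC: "D ** C = mat 1"
    using invA invB by simp
  \<comment> \<open>A one-sided inverse of a square matrix over a field is two-sided.\<close>
  then have CD: "C ** D = mat 1"
    by (simp add: matrix_left_right_inverse)
  \<comment> \<open>Membership of \<open>B\<close> in \<open>V\<close> enters here: it makes
    \<open>C\<close>, and hence \<open>D\<close>, commute with all of
    \<open>inv_translate A V\<close>.\<close>
  have "C \<in> inv_translate A V"
    using B(1) by (auto simp: C_def inv_translate_def)
  then have D: "D ** P = P ** D" if "P \<in> inv_translate A V" for P
    using commute_left_inverse[OF DC CD] comm that by blast
  \<comment> \<open>Inserting \<open>A ** matrix_inv A\<close> shows that
    \<open>inv_translate B V\<close> consists of the products \<open>D ** P\<close> with
    \<open>P\<close> in \<open>inv_translate A V\<close>.\<close>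
  have fac: "matrix_inv B ** X = D ** (matrix_inv A ** X)" for X
  proof -
    have "D ** (matrix_inv A ** X) = matrix_inv B ** (A ** matrix_inv A) ** X"
      by (simp add: D_def matrix_mul_assoc)
    then show ?thesis
      using invA by simp
  qed
  \<comment> \<open>Moving \<open>D\<close> to the left past \<open>P\<close> gives
    \<open>D ** D ** (P ** Q)\<close>, which is symmetric in \<open>P\<close> and \<open>Q\<close>;
    then one \<open>D\<close> moves back past \<open>Q\<close>.\<close>
  have "(D ** P) ** (D ** Q) = (D ** Q) ** (D ** P)"
    if "P \<in> inv_translate A V" "Q \<in> inv_translate A V" for P Q
  proof -
    have "(D ** P) ** (D ** Q) = D ** (P ** D) ** Q"
      by (simp add: matrix_mul_assoc)
    also have "\<dots> = D ** D ** (P ** Q)"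
      by (simp add: D[OF that(1), symmetric] matrix_mul_assoc)
    also have "\<dots> = D ** (D ** Q) ** P"
      by (simp add: comm[OF that] matrix_mul_assoc)
    also have "\<dots> = (D ** Q) ** (D ** P)"
      by (simp add: D[OF that(2)] matrix_mul_assoc)
    finally show ?thesis .
  qed
  then have "X ** Y = Y ** X" if "X \<in> inv_translate B V" "Y \<in> inv_translate B V" for X Y
    using that by (auto simp: inv_translate_def fac)
  then show ?thesis
    using subspace_inv_translate[OF V] by (simp add: commuting_subspace_def)
qed

text \<open>From left to right this is the change of base matrix; from right to left, the
  nonsingular element of \<open>V\<close> is the witness. A general field covers the real and
  complex cases together.\<close>

lemma commuting_inv_translate_iff:
  fixes V :: "('a::field^'n^'n) set"
  assumes "matrix_space.subspace V" "\<exists>A\<in>V. invertible A"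
  shows "(\<exists>A\<in>V. invertible A \<and> commuting_subspace (inv_translate A V)) \<longleftrightarrow>
         (\<forall>A\<in>V. invertible A \<longrightarrow> commuting_subspace (inv_translate A V))"
  using assms commuting_inv_translate_change[of V] by blast

theorem theorem2p6:
  shows "(\<forall>V :: (real^'n^'n) set.
            matrix_space.subspace V \<and> (\<exists>A\<in>V. invertible A) \<longrightarrow>
            ((\<exists>A\<in>V. invertible A \<and> commuting_subspace (inv_translate A V)) \<longleftrightarrow>
             (\<forall>A\<in>V. invertible A \<longrightarrow> commuting_subspace (inv_translate A V))))
       \<and> (\<forall>V :: (complex^'n^'n) set.
            matrix_space.subspace V \<and> (\<exists>A\<in>V. invertible A) \<longrightarrow>
            ((\<exists>A\<in>V. invertible A \<and> commuting_subspace (inv_translate A V)) \<longleftrightarrow>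
             (\<forall>A\<in>V. invertible A \<longrightarrow> commuting_subspace (inv_translate A V))))"
  by (intro conjI allI impI commuting_inv_translate_iff) simp_all

end
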